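(* Let $k\ge 3$ and $m\ge 2$ be integers and let $\mathcal{T}$ be a $k$-uniform supertree on $n$ vertices with $m=\frac{n-1}{k-1}$ edges. Then $$\log(km)-\frac{\log m}{k}\;\le\; I_d^1(\mathcal{T})\;\le\;\log(km)-\frac{2(m-1)\log 2}{km},$$ where equality holds in the first inequality if and only if $\mathcal{T}$ is isomorphic to the hyperstar $S^k_{m+1}$, and equality holds in the second inequality if and only if the maximum vertex degree of $\mathcal{T}$ is $2$.
   Context: All logarithms are to base $2$. A $k$-uniform hypergraph $\mathcal{H}$ consists of a finite vertex set and a set of distinct edges, each edge being a $k$-element subset of the vertex set (so hypergraphs are simple). The degree $d_v$ of a vertex $v$ is the number of edges containing $v$. A walk is a sequence $v_0e_1v_1e_2\cdots e_lv_l$ with $\{v_{i-1},v_i\}\subseteq e_i$; $\mathcal{H}$ is connected if any two vertices are joined by a walk. A cycle is a walk with $l\ge 2$, $v_0=v_l$, and no other repetition of vertices or edges. A supertree is a connected hypergraph containing no cycle; equivalently, a connected $k$-uniform hypergraph with $n$ vertices and $m$ edges is a supertree iff $m(k-1)=n-1$. The hyperstar $S^k_{m+1}$ is the $k$-uniform hypergraph with $m$ edges that all contain one common vertex and are otherwise pairwise disjoint (the $k$-th power of the star with $m+1$ vertices). For a hypergraph with vertex degrees $d_1,\dots,d_n$ (all positive), the first degree-based graph entropy is $$I_d^1(\mathcal{H})=-\sum_{i=1}^n\frac{d_i}{\sum_{j=1}^n d_j}\log\frac{d_i}{\sum_{j=1}^n d_j}.$$ *)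

theory Defs
  imports Complex_Main
begin

definition uniform_hypergraph :: "nat \<Rightarrow> 'a set \<Rightarrow> 'a set set \<Rightarrow> bool" where
  "uniform_hypergraph k V E \<longleftrightarrow> finite V \<and> (\<forall>e\<in>E. e \<subseteq> V \<and> card e = k)"

definition degree :: "'a set set \<Rightarrow> 'a \<Rightarrow> nat" where
  "degree E v = card {e \<in> E. v \<in> e}"

(* The walk v_0 e_1 v_1 ... e_l v_l is given by vs = [v_0, ..., v_l] and es = [e_1, ..., e_l];
   the edge e_(i+1) is es ! i.  Walks of length l = 0 are allowed. *)
definition walk :: "'a set \<Rightarrow> 'a set set \<Rightarrow> 'a list \<Rightarrow> 'a set list \<Rightarrow> bool" where
  "walk V E vs es \<longleftrightarrow>
     length vs = Suc (length es) \<and> set vs \<subseteq> V \<and> set es \<subseteq> E \<and>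
     (\<forall>i < length es. {vs ! i, vs ! Suc i} \<subseteq> es ! i)"

definition connected_hypergraph :: "'a set \<Rightarrow> 'a set set \<Rightarrow> bool" where
  "connected_hypergraph V E \<longleftrightarrow>
     (\<forall>u\<in>V. \<forall>v\<in>V. \<exists>vs es. walk V E vs es \<and> hd vs = u \<and> last vs = v)"

definition cycle :: "'a set \<Rightarrow> 'a set set \<Rightarrow> 'a list \<Rightarrow> 'a set list \<Rightarrow> bool" where
  "cycle V E vs es \<longleftrightarrow>
     walk V E vs es \<and> length es \<ge> 2 \<and> hd vs = last vs \<and> distinct (tl vs) \<and> distinct es"

definition supertree :: "nat \<Rightarrow> 'a set \<Rightarrow> 'a set set \<Rightarrow> bool" where
  "supertree k V E \<longleftrightarrow>
     uniform_hypergraph k V E \<and> connected_hypergraph V E \<and> (\<nexists>vs es. cycle V E vs es)"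

definition isomorphic_hypergraphs ::
    "'a set \<Rightarrow> 'a set set \<Rightarrow> 'b set \<Rightarrow> 'b set set \<Rightarrow> bool" where
  "isomorphic_hypergraphs V E V' E' \<longleftrightarrow>
     (\<exists>f. bij_betw f V V' \<and> (\<lambda>e. f ` e) ` E = E')"

(* The hyperstar with m edges: None is the common vertex, and the vertices Some (i, j)
   with j < k - 1 are the remaining k - 1 vertices of the i-th edge. *)
definition hyperstar_verts :: "nat \<Rightarrow> nat \<Rightarrow> (nat \<times> nat) option set" where
  "hyperstar_verts k m = insert None (Some ` ({..<m} \<times> {..<k - 1}))"

definition hyperstar_edges :: "nat \<Rightarrow> nat \<Rightarrow> (nat \<times> nat) option set set" where
  "hyperstar_edges k m = (\<lambda>i. insert None (Some ` ({i} \<times> {..<k - 1}))) ` {..<m}"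

definition degree_entropy :: "'a set \<Rightarrow> 'a set set \<Rightarrow> real" where
  "degree_entropy V E =
     - (\<Sum>v\<in>V. real (degree E v) / (\<Sum>u\<in>V. real (degree E u)) *
          log 2 (real (degree E v) / (\<Sum>u\<in>V. real (degree E u))))"

end

theory Submission
  imports Defs
begin

text \<open>
  Writing s for the sum of the degrees d, the entropy is log s minus the sum of the d log d divided
  by s. As x log x vanishes at 1, d log d is d - 1 times the slope of the chord of x log x between
  1 and d, and by convexity that slope increases strictly with d. The degrees other than 1 lie
  between 2 and m, so their slopes lie between the slopes at 2 and at m. In a supertree the
  excesses d - 1 add up to m - 1, and summing over the vertices yields both bounds, with equality
  iff all degrees belong to {1, m} or to {1, 2}, respectively. In the first case a single vertex of
  degree m uses up the total excess, so all others have degree 1.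
\<close>

section \<open>Chords of the function $x \log x$\<close>

text \<open>The junk value at 1 is harmless: only the product of the slope with \<open>x - 1\<close> matters there.\<close>

definition mult_log_slope :: "real \<Rightarrow> real \<Rightarrow> real" where
  "mult_log_slope b x = x * log b x / (x - 1)"

lemma mult_log_eq_slope: "x * log b x = (x - 1) * mult_log_slope b x"
  by (simp add: mult_log_slope_def)

lemma strict_mono_on_mult_log_slope:
  assumes "1 < b"
  shows "strict_mono_on {1<..} (mult_log_slope b)"
proof (rule strict_mono_onI)
  fix x y :: real
  assume "x \<in> {1<..}" "x < y"
  show "mult_log_slope b x < mult_log_slope b y"
  proof (rule DERIV_pos_imp_increasing[OF \<open>x < y\<close>])
    fix z assume "x \<le> z"
    with \<open>x \<in> {1<..}\<close> have "1 < z" by simp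
    hence "((\<lambda>z. z * ln z / (z - 1)) has_real_derivative (z - 1 - ln z) / (z - 1)\<^sup>2) (at z)"
      by (auto intro!: derivative_eq_intros simp: field_simps power2_eq_square)
    hence "((\<lambda>z. z * ln z / (z - 1) / ln b) has_real_derivative
        (z - 1 - ln z) / (z - 1)\<^sup>2 / ln b) (at z)"
      by (intro DERIV_cdivide)
    moreover have "mult_log_slope b = (\<lambda>z. z * ln z / (z - 1) / ln b)"
      by (simp add: fun_eq_iff mult_log_slope_def log_def)
    moreover have "ln z < z - 1"
      using ln_add_one_self_less_self[of "z - 1"] \<open>1 < z\<close> by simp
    ultimately show "\<exists>D. (mult_log_slope b has_real_derivative D) (at z) \<and> 0 < D"
      using \<open>1 < z\<close> \<open>1 < b\<close> by (intro exI conjI) auto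
  qed
qed

lemma
  assumes "1 < b" "1 \<le> x" "1 < c"
  shows mult_log_le_slope_iff: "x * log b x \<le> (x - 1) * mult_log_slope b c \<longleftrightarrow> x \<le> c"
    and slope_le_mult_log_iff: "(x - 1) * mult_log_slope b c \<le> x * log b x \<longleftrightarrow> x = 1 \<or> c \<le> x"
proof -
  have "mult_log_slope b x \<le> mult_log_slope b c \<longleftrightarrow> x \<le> c"
    "mult_log_slope b c \<le> mult_log_slope b x \<longleftrightarrow> c \<le> x" if "1 < x"
    using strict_mono_on_less_eq[OF strict_mono_on_mult_log_slope[OF \<open>1 < b\<close>]] that \<open>1 < c\<close>
    by auto
  thus "x * log b x \<le> (x - 1) * mult_log_slope b c \<longleftrightarrow> x \<le> c"
    and "(x - 1) * mult_log_slope b c \<le> x * log b x \<longleftrightarrow> x = 1 \<or> c \<le> x"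
    unfolding mult_log_eq_slope using assms by (cases "x = 1"; simp add: mult_le_cancel_left_pos)+
qed

lemma mult_log_eq_slope_iff:
  assumes "1 < b" "1 \<le> x" "1 < c"
  shows "x * log b x = (x - 1) * mult_log_slope b c \<longleftrightarrow> x = 1 \<or> x = c"
  using mult_log_le_slope_iff[OF assms] slope_le_mult_log_iff[OF assms] \<open>1 < c\<close>
  by (auto simp: order_eq_iff)

lemma sum_mult_log_eq_slope_iff:
  fixes f :: "'a \<Rightarrow> real"
  assumes "1 < b" "1 < c" "finite A" "\<forall>x\<in>A. 1 \<le> f x"
    and range: "(\<forall>x\<in>A. f x \<le> c) \<or> (\<forall>x\<in>A. f x = 1 \<or> c \<le> f x)"
  shows "(\<Sum>x\<in>A. f x * log b (f x)) = (\<Sum>x\<in>A. f x - 1) * mult_log_slope b c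
    \<longleftrightarrow> (\<forall>x\<in>A. f x = 1 \<or> f x = c)"
proof -
  let ?g = "\<lambda>x. f x * log b (f x)" and ?h = "\<lambda>x. (f x - 1) * mult_log_slope b c"
  have "(\<forall>x\<in>A. ?g x \<le> ?h x) \<or> (\<forall>x\<in>A. ?h x \<le> ?g x)"
    using assms(1,2,4) range by (simp add: mult_log_le_slope_iff slope_le_mult_log_iff)
  hence "\<forall>x\<in>A. ?g x = ?h x" if "sum ?g A = sum ?h A"
    using sum_mono_inv[OF that] sum_mono_inv[OF that[symmetric]] assms(3) by metis
  hence "sum ?g A = sum ?h A \<longleftrightarrow> (\<forall>x\<in>A. ?g x = ?h x)"
    by (metis (mono_tags, lifting) sum.cong)
  also have "\<dots> \<longleftrightarrow> (\<forall>x\<in>A. f x = 1 \<or> f x = c)"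
    using assms(1,2,4) by (simp add: mult_log_eq_slope_iff)
  finally show ?thesis by (simp add: sum_distrib_right)
qed

section \<open>Entropy of a weighted set\<close>

definition weight_entropy :: "real \<Rightarrow> 'a set \<Rightarrow> ('a \<Rightarrow> real) \<Rightarrow> real" where
  "weight_entropy b A f = - (\<Sum>x\<in>A. f x / sum f A * log b (f x / sum f A))"

lemma degree_entropy_eq_weight_entropy:
  "degree_entropy V E = weight_entropy 2 V (\<lambda>v. real (degree E v))"
  by (simp add: degree_entropy_def weight_entropy_def)

lemma weight_entropy_eq:
  assumes "finite A" "A \<noteq> {}" "\<And>x. x \<in> A \<Longrightarrow> 0 < f x"
  shows "weight_entropy b A f = log b (sum f A) - (\<Sum>x\<in>A. f x * log b (f x)) / sum f A"
proof -
  have total_pos: "0 < sum f A" using assms by (intro sum_pos) auto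
  have "f x / sum f A * log b (f x / sum f A)
      = f x * log b (f x) / sum f A - f x * (log b (sum f A) / sum f A)" if "x \<in> A" for x
    using assms(3)[OF that] total_pos by (simp add: log_divide field_simps)
  hence "weight_entropy b A f
      = - (\<Sum>x\<in>A. f x * log b (f x) / sum f A - f x * (log b (sum f A) / sum f A))"
    by (simp add: weight_entropy_def)
  also have "\<dots> = log b (sum f A) - (\<Sum>x\<in>A. f x * log b (f x)) / sum f A"
    using total_pos by (simp add: sum_subtractf flip: sum_distrib_right sum_divide_distrib)
  finally show ?thesis .
qed

context
  fixes b c :: real and A :: "'a set" and f :: "'a \<Rightarrow> real"
  assumes "1 < b" "1 < c" "finite A" "A \<noteq> {}" and f_ge_1: "\<forall>x\<in>A. 1 \<le> f x"
begin

private lemma f_pos: "x \<in> A \<Longrightarrow> 0 < f x"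
  using f_ge_1 by (meson less_le_trans zero_less_one)

private lemma total_pos: "0 < sum f A"
  using \<open>finite A\<close> \<open>A \<noteq> {}\<close> f_pos by (rule sum_pos)

private lemma entropy_eq:
  "weight_entropy b A f = log b (sum f A) - (\<Sum>x\<in>A. f x * log b (f x)) / sum f A"
  using \<open>finite A\<close> \<open>A \<noteq> {}\<close> f_pos by (rule weight_entropy_eq)

lemma weight_entropy_ge:
  assumes "\<forall>x\<in>A. f x \<le> c"
  shows "log b (sum f A) - (\<Sum>x\<in>A. f x - 1) * mult_log_slope b c / sum f A \<le> weight_entropy b A f"
  unfolding entropy_eq sum_distrib_right
  using assms \<open>1 < b\<close> \<open>1 < c\<close> f_ge_1 total_pos
  by (intro diff_left_mono divide_right_mono sum_mono) (simp_all add: mult_log_le_slope_iff)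

lemma weight_entropy_le:
  assumes "\<forall>x\<in>A. f x = 1 \<or> c \<le> f x"
  shows "weight_entropy b A f \<le> log b (sum f A) - (\<Sum>x\<in>A. f x - 1) * mult_log_slope b c / sum f A"
  unfolding entropy_eq sum_distrib_right
  using assms \<open>1 < b\<close> \<open>1 < c\<close> f_ge_1 total_pos
  by (intro diff_left_mono divide_right_mono sum_mono) (simp_all add: slope_le_mult_log_iff)

lemma weight_entropy_eq_iff:
  assumes "(\<forall>x\<in>A. f x \<le> c) \<or> (\<forall>x\<in>A. f x = 1 \<or> c \<le> f x)"
  shows "weight_entropy b A f = log b (sum f A) - (\<Sum>x\<in>A. f x - 1) * mult_log_slope b c / sum f A
    \<longleftrightarrow> (\<forall>x\<in>A. f x = 1 \<or> f x = c)"
  unfolding entropy_eq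
    sum_mult_log_eq_slope_iff[OF \<open>1 < b\<close> \<open>1 < c\<close> \<open>finite A\<close> f_ge_1 assms, symmetric]
  using total_pos by simp

end

section \<open>Vertex degrees\<close>

lemma finite_edges: "uniform_hypergraph k V E \<Longrightarrow> finite E"
  by (auto simp: uniform_hypergraph_def intro: finite_subset[of E "Pow V"])

lemma degree_le_card: "finite E \<Longrightarrow> degree E v \<le> card E"
  unfolding degree_def by (intro card_mono) auto

lemma degree_eq_card_iff:
  assumes "finite E"
  shows "degree E v = card E \<longleftrightarrow> (\<forall>e\<in>E. v \<in> e)"
proof
  assume "degree E v = card E"
  hence "{e \<in> E. v \<in> e} = E"
    unfolding degree_def using assms by (intro card_subset_eq) auto
  thus "\<forall>e\<in>E. v \<in> e" by auto
next
  assume "\<forall>e\<in>E. v \<in> e"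
  hence "{e \<in> E. v \<in> e} = E" by auto
  thus "degree E v = card E" by (simp add: degree_def)
qed

lemma degree_eq_1_iff: "degree E v = 1 \<longleftrightarrow> (\<exists>!e. e \<in> E \<and> v \<in> e)"
  unfolding degree_def is_singleton_altdef[symmetric] is_singleton_iff_ex1 by simp

lemma sum_degree:
  assumes "uniform_hypergraph k V E"
  shows "(\<Sum>v\<in>V. degree E v) = k * card E"
  unfolding degree_def
proof (rule sum_multicount)
  have "{v \<in> V. v \<in> e} = e" if "e \<in> E" for e
    using that assms by (auto simp: uniform_hypergraph_def)
  thus "\<forall>e\<in>E. card {v \<in> V. v \<in> e} = k"
    using assms by (simp add: uniform_hypergraph_def)
qed (use assms finite_edges in \<open>auto simp: uniform_hypergraph_def\<close>)

lemma walk_hd_in_edge: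
  assumes "walk V E vs es" "hd vs \<noteq> last vs"
  shows "\<exists>e\<in>E. hd vs \<in> e"
proof (cases es)
  case Nil
  with assms show ?thesis by (auto simp: walk_def length_Suc_conv)
next
  case (Cons e es')
  with assms(1) have "e \<in> E" "vs ! 0 \<in> e" "vs \<noteq> []" by (auto simp: walk_def)
  thus ?thesis by (auto simp: hd_conv_nth)
qed

lemma connected_hypergraph_degree_pos:
  assumes "connected_hypergraph V E" "finite E" "1 < card V" "v \<in> V"
  shows "0 < degree E v"
proof -
  have "\<not> V \<subseteq> {v}"
    using assms(3) card_mono[of "{v}" V] by auto
  then obtain u where "u \<in> V" "u \<noteq> v" by blast
  then obtain vs es where "walk V E vs es" "hd vs = v" "last vs = u"
    using assms(1,4) unfolding connected_hypergraph_def by blast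
  hence "\<exists>e\<in>E. v \<in> e" using walk_hd_in_edge \<open>u \<noteq> v\<close> by metis
  thus ?thesis using \<open>finite E\<close> by (auto simp: degree_def card_gt_0_iff)
qed

lemma Max_image_eq_2_iff:
  fixes f :: "'a \<Rightarrow> nat"
  assumes "finite A" "\<And>x. x \<in> A \<Longrightarrow> 0 < f x" "\<exists>x\<in>A. f x \<noteq> 1"
  shows "Max (f ` A) = 2 \<longleftrightarrow> (\<forall>x\<in>A. f x = 1 \<or> f x = 2)"
proof -
  have le_2_iff: "f x \<le> 2 \<longleftrightarrow> f x = 1 \<or> f x = 2" if "x \<in> A" for x
    using assms(2)[OF that] by linarith
  have "Max (f ` A) = 2 \<longleftrightarrow> (\<exists>x\<in>A. f x = 2) \<and> (\<forall>x\<in>A. f x \<le> 2)"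
    using assms(1,3) by (subst Max_eq_iff) (auto simp: image_iff eq_commute)
  also have "\<dots> \<longleftrightarrow> (\<forall>x\<in>A. f x = 1 \<or> f x = 2)"
    using assms(3) le_2_iff by blast
  finally show ?thesis .
qed

section \<open>Hyperstars\<close>

definition star_center :: "'a set \<Rightarrow> 'a set set \<Rightarrow> 'a \<Rightarrow> bool" where
  "star_center V E c \<longleftrightarrow>
     V = insert c (\<Union>E) \<and> (\<forall>e\<in>E. c \<in> e) \<and> pairwise (\<lambda>e e'. e \<inter> e' = {c}) E"

lemma degree_eq_1_if_star_center:
  assumes "star_center V E c" "v \<in> V" "v \<noteq> c"
  shows "degree E v = 1"
proof -
  have verts: "V = insert c (\<Union>E)" and disjoint: "pairwise (\<lambda>e e'. e \<inter> e' = {c}) E"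
    using assms(1) by (simp_all add: star_center_def)
  have "v \<in> \<Union>E" using assms(2,3) unfolding verts by simp
  then obtain e where "e \<in> E" "v \<in> e" by (rule UnionE)
  have "e' = e" if "e' \<in> E" "v \<in> e'" for e'
  proof (rule ccontr)
    assume "e' \<noteq> e"
    with disjoint that(1) \<open>e \<in> E\<close> have "e' \<inter> e = {c}" by (rule pairwiseD)
    with that(2) \<open>v \<in> e\<close> \<open>v \<noteq> c\<close> show False by blast
  qed
  with \<open>e \<in> E\<close> \<open>v \<in> e\<close> show ?thesis
    unfolding degree_eq_1_iff by metis
qed

lemma star_centerI_degree:
  assumes "finite E" "\<Union>E \<subseteq> V"
    and "c \<in> V" "degree E c = card E" "\<And>v. v \<in> V - {c} \<Longrightarrow> degree E v = 1"
  shows "star_center V E c"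
proof -
  have ex1_edge: "\<exists>!e. e \<in> E \<and> v \<in> e" if "v \<in> V - {c}" for v
    using assms(5)[OF that] unfolding degree_eq_1_iff .
  have common: "\<forall>e\<in>E. c \<in> e"
    using assms(4) by (simp add: degree_eq_card_iff[OF assms(1)])
  have "V - {c} \<subseteq> \<Union>E"
    using ex1_edge by (metis UnionI subsetI)
  hence "V = insert c (\<Union>E)" using assms(2,3) by blast
  moreover have "e \<inter> e' = {c}" if "e \<in> E" "e' \<in> E" "e \<noteq> e'" for e e'
  proof
    have "v \<notin> V - {c}" if "v \<in> e" "v \<in> e'" for v
      using ex1_edge[of v] \<open>e \<in> E\<close> \<open>e' \<in> E\<close> \<open>e \<noteq> e'\<close> that by metis
    thus "e \<inter> e' \<subseteq> {c}" using assms(2) \<open>e \<in> E\<close> by blast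
    show "{c} \<subseteq> e \<inter> e'" using common \<open>e \<in> E\<close> \<open>e' \<in> E\<close> by simp
  qed
  ultimately show ?thesis
    using common by (simp add: star_center_def pairwise_def)
qed

lemma isomorphic_hypergraphs_sym:
  assumes "isomorphic_hypergraphs V E V' E'" "\<Union>E \<subseteq> V"
  shows "isomorphic_hypergraphs V' E' V E"
proof -
  obtain f where f: "bij_betw f V V'" "(`) f ` E = E'"
    using assms(1) by (auto simp: isomorphic_hypergraphs_def)
  have "inv_into V f ` f ` e = e" if "e \<in> E" for e
    using that assms(2) f(1) by (intro inv_into_image_cancel) (auto simp: bij_betw_def)
  hence "(`) (inv_into V f) ` E' = E"
    by (force simp flip: f(2) simp: image_image)
  thus ?thesis
    using bij_betw_inv_into[OF f(1)] by (auto simp: isomorphic_hypergraphs_def)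
qed

lemma star_center_image:
  assumes "star_center V E c" "inj_on f V"
  shows "star_center (f ` V) ((`) f ` E) (f c)"
proof -
  have verts: "V = insert c (\<Union>E)" and disjoint: "pairwise (\<lambda>e e'. e \<inter> e' = {c}) E"
    using assms(1) by (simp_all add: star_center_def)
  have "f ` e \<inter> f ` e' = {f c}" if "e \<in> E" "e' \<in> E" "f ` e \<noteq> f ` e'" for e e'
  proof -
    have "e \<subseteq> V" "e' \<subseteq> V" using that(1,2) unfolding verts by blast+
    hence "f ` e \<inter> f ` e' = f ` (e \<inter> e')"
      by (simp add: inj_on_image_Int[OF assms(2)])
    moreover have "e \<inter> e' = {c}"
      using that by (intro pairwiseD[OF disjoint]) auto
    ultimately show ?thesis by simp
  qed
  thus ?thesis using assms(1) by (simp add: star_center_def pairwise_image pairwise_def image_Union)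
qed

lemma star_center_hyperstar: "star_center (hyperstar_verts k m) (hyperstar_edges k m) None"
  by (auto simp: star_center_def hyperstar_verts_def hyperstar_edges_def pairwise_def)

lemma disjoint_sets_labelling:
  assumes card: "\<And>i. i \<in> I \<Longrightarrow> finite (D i) \<and> card (D i) = r"
    and disjoint: "\<And>i j. i \<in> I \<Longrightarrow> j \<in> I \<Longrightarrow> i \<noteq> j \<Longrightarrow> D i \<inter> D j = {}"
  obtains f where "inj_on f (I \<times> {..<r})" "\<And>i. i \<in> I \<Longrightarrow> f ` ({i} \<times> {..<r}) = D i"
proof -
  have "\<exists>g. inj_on g {..<r} \<and> g ` {..<r} = D i" if "i \<in> I" for i
    using card[OF that] ex_bij_betw_nat_finite[of "D i"]
    by (auto simp: atLeast0LessThan bij_betw_def)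
  then obtain g where g_inj: "inj_on (g i) {..<r}" and g_image: "g i ` {..<r} = D i"
    if "i \<in> I" for i by metis
  have g_mem: "g i j \<in> D i" if "i \<in> I" "j < r" for i j
    unfolding g_image[OF that(1), symmetric] using that(2) by simp
  define f where "f = (\<lambda>(i, j). g i j)"
  show thesis
  proof
    show "inj_on f (I \<times> {..<r})"
    proof (rule inj_onI, clarify)
      fix i j i' j'
      assume mem: "i \<in> I" "i' \<in> I" "j < r" "j' < r" and "f (i, j) = f (i', j')"
      hence eq: "g i j = g i' j'" by (simp add: f_def)
      hence "g i j \<in> D i \<inter> D i'" using g_mem[of i j] g_mem[of i' j'] mem by simp
      hence "i = i'" using disjoint[of i i'] mem by blast
      with inj_onD[OF g_inj[OF mem(1)]] eq mem show "i = i' \<and> j = j'" by simp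
    qed
    show "f ` ({i} \<times> {..<r}) = D i" if "i \<in> I" for i
      unfolding g_image[OF that, symmetric] by (force simp: f_def)
  qed
qed

lemma star_center_labelling:
  assumes "uniform_hypergraph k V E" "star_center V E c"
  obtains f where "inj_on f ({..<card E} \<times> {..<k - 1})" "c \<notin> f ` ({..<card E} \<times> {..<k - 1})"
    "(\<lambda>i. insert c (f ` ({i} \<times> {..<k - 1}))) ` {..<card E} = E"
proof -
  obtain h where h: "inj_on h {..<card E}" "h ` {..<card E} = E"
    using ex_bij_betw_nat_finite[OF finite_edges[OF assms(1)]]
    by (auto simp: atLeast0LessThan bij_betw_def)
  have edge: "h i \<in> E" "c \<in> h i" "finite (h i)" "card (h i) = k" if "i < card E" for i
  proof -
    show "h i \<in> E" using that h(2) by auto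
    thus "c \<in> h i" "finite (h i)" "card (h i) = k"
      using assms finite_subset[of "h i" V]
      by (simp_all add: star_center_def uniform_hypergraph_def)
  qed
  have disjoint: "(h i - {c}) \<inter> (h j - {c}) = {}" if "i < card E" "j < card E" "i \<noteq> j" for i j
  proof -
    have "h i \<noteq> h j" using h(1) that by (auto dest: inj_onD)
    with assms(2) edge(1) that have "h i \<inter> h j = {c}" by (simp add: star_center_def pairwise_def)
    thus ?thesis by blast
  qed
  obtain f where f: "inj_on f ({..<card E} \<times> {..<k - 1})"
    and f_image: "\<And>i. i \<in> {..<card E} \<Longrightarrow> f ` ({i} \<times> {..<k - 1}) = h i - {c}"
    using disjoint_sets_labelling[of "{..<card E}" "\<lambda>i. h i - {c}" "k - 1"] edge disjoint
    by auto
  show thesis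
  proof (rule that[OF f])
    show "c \<notin> f ` ({..<card E} \<times> {..<k - 1})" using f_image by fastforce
    have "(\<lambda>i. insert c (f ` ({i} \<times> {..<k - 1}))) ` {..<card E} = h ` {..<card E}"
      using f_image edge(2) by (intro image_cong) (simp_all add: insert_absorb)
    thus "(\<lambda>i. insert c (f ` ({i} \<times> {..<k - 1}))) ` {..<card E} = E"
      unfolding h(2) .
  qed
qed

lemma isomorphic_hyperstar_if_star_center:
  assumes "uniform_hypergraph k V E" "star_center V E c"
  shows "isomorphic_hypergraphs V E (hyperstar_verts k (card E)) (hyperstar_edges k (card E))"
proof -
  let ?V = "hyperstar_verts k (card E)" and ?E = "hyperstar_edges k (card E)"
  obtain f where f: "inj_on f ({..<card E} \<times> {..<k - 1})" "c \<notin> f ` ({..<card E} \<times> {..<k - 1})"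
    "(\<lambda>i. insert c (f ` ({i} \<times> {..<k - 1}))) ` {..<card E} = E"
    by (rule star_center_labelling[OF assms])
  let ?F = "case_option c f"
  have inj: "inj_on ?F ?V"
    using f(1,2) by (auto simp: hyperstar_verts_def inj_on_def)
  have edges: "(`) ?F ` ?E = E"
    using f(3) by (simp add: hyperstar_edges_def image_image)
  have "?V = insert None (\<Union>?E)"
    using star_center_hyperstar by (simp add: star_center_def)
  hence "?F ` ?V = insert c (\<Union>E)"
    by (simp add: image_Union edges)
  also have "\<dots> = V"
    using assms(2) by (simp add: star_center_def)
  finally have "isomorphic_hypergraphs ?V ?E V E"
    using inj edges by (auto simp: isomorphic_hypergraphs_def bij_betw_def)
  moreover have "\<Union>?E \<subseteq> ?V"
    using \<open>?V = insert None (\<Union>?E)\<close> by blast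
  ultimately show ?thesis by (rule isomorphic_hypergraphs_sym)
qed

lemma isomorphic_hyperstar_iff:
  assumes "uniform_hypergraph k V E"
  shows "isomorphic_hypergraphs V E (hyperstar_verts k (card E)) (hyperstar_edges k (card E))
    \<longleftrightarrow> (\<exists>c. star_center V E c)"
    (is "?iso \<longleftrightarrow> _")
proof
  have "\<Union>E \<subseteq> V" using assms by (auto simp: uniform_hypergraph_def)
  moreover assume ?iso
  ultimately obtain f where "inj_on f (hyperstar_verts k (card E))"
    "f ` hyperstar_verts k (card E) = V" "(`) f ` hyperstar_edges k (card E) = E"
    using isomorphic_hypergraphs_sym unfolding isomorphic_hypergraphs_def bij_betw_def by metis
  with star_center_image[OF star_center_hyperstar]
  show "\<exists>c. star_center V E c" by metis
next
  assume "\<exists>c. star_center V E c"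
  thus ?iso using isomorphic_hyperstar_if_star_center[OF assms] by blast
qed

section \<open>Supertrees\<close>

text \<open>Acyclicity is encoded by the edge count, the least possible for a connected hypergraph.\<close>

locale hypertree =
  fixes k :: nat and V :: "'a set" and E :: "'a set set"
  assumes uniform: "uniform_hypergraph k V E"
    and connected: "connected_hypergraph V E"
    and edge_count: "real (card E) * (real k - 1) = real (card V) - 1"
    and k_ge_2: "2 \<le> k"
    and card_edges_ge_2: "2 \<le> card E"
begin

lemma finite_vertices: "finite V" and Union_edges_subset: "\<Union>E \<subseteq> V"
  using uniform by (auto simp: uniform_hypergraph_def)

lemma degree_pos:
  assumes "v \<in> V"
  shows "0 < degree E v"
proof -
  have "0 < real (card E) * (real k - 1)"
    using k_ge_2 card_edges_ge_2 by simp
  hence "1 < card V" using edge_count by linarith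
  thus ?thesis
    using connected_hypergraph_degree_pos[OF connected finite_edges[OF uniform] _ assms] by simp
qed

abbreviation weight :: "'a \<Rightarrow> real" where
  "weight v \<equiv> real (degree E v)"

lemma sum_weight: "sum weight V = real k * real (card E)"
  using sum_degree[OF uniform] by (simp flip: of_nat_sum)

lemma sum_weight_minus_1: "(\<Sum>v\<in>V. weight v - 1) = real (card E) - 1"
  using sum_weight edge_count by (simp add: sum_subtractf algebra_simps)

lemma exists_degree_neq_1: "\<exists>v\<in>V. degree E v \<noteq> 1"
proof (rule ccontr)
  assume "\<not> ?thesis"
  hence "(\<Sum>v\<in>V. weight v - 1) = 0" by simp
  with sum_weight_minus_1 card_edges_ge_2 show False by simp
qed

lemma Max_degree_eq_2_iff: "Max (degree E ` V) = 2 \<longleftrightarrow> (\<forall>v\<in>V. degree E v = 1 \<or> degree E v = 2)"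
  using finite_vertices degree_pos exists_degree_neq_1 by (rule Max_image_eq_2_iff)

lemma star_center_if_degrees_1_or_card:
  assumes "\<forall>v\<in>V. degree E v = 1 \<or> degree E v = card E"
  shows "\<exists>c. star_center V E c"
proof -
  obtain c where c: "c \<in> V" "degree E c = card E"
    using assms exists_degree_neq_1 by blast
  have "(\<Sum>v\<in>V - {c}. weight v - 1) = 0"
    using sum.remove[OF finite_vertices c(1), of "\<lambda>v. weight v - 1"]
      sum_weight_minus_1 c(2) by simp
  hence "\<forall>v\<in>V - {c}. degree E v = 1"
    using finite_vertices degree_pos
    by (subst (asm) sum_nonneg_eq_0_iff) (auto simp: Suc_le_eq)
  with c have "star_center V E c"
    using finite_edges[OF uniform] Union_edges_subset by (intro star_centerI_degree) auto
  thus ?thesis ..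
qed

lemma isomorphic_hyperstar_iff_degrees:
  "isomorphic_hypergraphs V E (hyperstar_verts k (card E)) (hyperstar_edges k (card E))
    \<longleftrightarrow> (\<forall>v\<in>V. degree E v = 1 \<or> degree E v = card E)"
  unfolding isomorphic_hyperstar_iff[OF uniform]
proof
  assume "\<exists>c. star_center V E c"
  then obtain c where center: "star_center V E c" ..
  hence "degree E c = card E"
    using finite_edges[OF uniform] by (simp add: star_center_def degree_eq_card_iff)
  with degree_eq_1_if_star_center[OF center]
  show "\<forall>v\<in>V. degree E v = 1 \<or> degree E v = card E" by metis
qed (rule star_center_if_degrees_1_or_card)

lemma degree_weights:
  "finite V" "V \<noteq> {}" "\<forall>v\<in>V. 1 \<le> weight v"
  using finite_vertices exists_degree_neq_1 degree_pos by (auto simp: Suc_le_eq)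

lemma
  shows degree_entropy_ge:
    "log 2 (real k * real (card E)) - log 2 (card E) / k \<le> degree_entropy V E" (is "?bound \<le> _")
    and degree_entropy_eq_lower_iff:
    "log 2 (real k * real (card E)) - log 2 (card E) / k = degree_entropy V E
      \<longleftrightarrow> isomorphic_hypergraphs V E (hyperstar_verts k (card E)) (hyperstar_edges k (card E))"
    (is "_ \<longleftrightarrow> ?iso")
proof -
  have card_gt_1: "1 < real (card E)" using card_edges_ge_2 by simp
  have range: "\<forall>v\<in>V. weight v \<le> real (card E)"
    using degree_le_card[OF finite_edges[OF uniform]] by simp
  have bound: "?bound = log 2 (sum weight V)
      - (\<Sum>v\<in>V. weight v - 1) * mult_log_slope 2 (card E) / sum weight V"
    using card_edges_ge_2 by (simp add: sum_weight sum_weight_minus_1 flip: mult_log_eq_slope)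
  show "?bound \<le> degree_entropy V E"
    unfolding bound degree_entropy_eq_weight_entropy
    using card_gt_1 degree_weights range by (intro weight_entropy_ge) simp_all
  have "degree_entropy V E = ?bound \<longleftrightarrow> (\<forall>v\<in>V. weight v = 1 \<or> weight v = card E)"
    unfolding bound degree_entropy_eq_weight_entropy
    using card_gt_1 degree_weights disjI1[OF range] by (intro weight_entropy_eq_iff) simp_all
  thus "?bound = degree_entropy V E \<longleftrightarrow> ?iso"
    by (simp add: isomorphic_hyperstar_iff_degrees eq_commute)
qed

lemma
  shows degree_entropy_le:
    "degree_entropy V E \<le>
      log 2 (real k * real (card E)) - 2 * (real (card E) - 1) * log 2 2 / (real k * real (card E))"
    (is "_ \<le> ?bound")
    and degree_entropy_eq_upper_iff:
    "degree_entropy V E =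
      log 2 (real k * real (card E)) - 2 * (real (card E) - 1) * log 2 2 / (real k * real (card E))
      \<longleftrightarrow> Max (degree E ` V) = 2"
proof -
  have range: "\<forall>v\<in>V. weight v = 1 \<or> 2 \<le> weight v"
    using degree_pos by force
  have bound: "?bound = log 2 (sum weight V)
      - (\<Sum>v\<in>V. weight v - 1) * mult_log_slope 2 2 / sum weight V"
    by (simp add: sum_weight sum_weight_minus_1 mult_log_slope_def)
  show "degree_entropy V E \<le> ?bound"
    unfolding bound degree_entropy_eq_weight_entropy
    using degree_weights range by (intro weight_entropy_le) simp_all
  have "degree_entropy V E = ?bound \<longleftrightarrow> (\<forall>v\<in>V. weight v = 1 \<or> weight v = 2)"
    unfolding bound degree_entropy_eq_weight_entropy
    using degree_weights disjI2[OF range] by (intro weight_entropy_eq_iff) simp_all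
  thus "degree_entropy V E = ?bound \<longleftrightarrow> Max (degree E ` V) = 2"
    by (simp add: Max_degree_eq_2_iff)
qed

end

theorem theorem1:
  fixes V :: "'a set" and E :: "'a set set" and k m n :: nat
  assumes "k \<ge> 3" and "m \<ge> 2"
    and "supertree k V E"
    and "card V = n" and "card E = m"
    and "real m = (real n - 1) / (real k - 1)"
  shows "log 2 (real k * real m) - log 2 (real m) / real k \<le> degree_entropy V E \<and>
         degree_entropy V E
           \<le> log 2 (real k * real m) - 2 * (real m - 1) * log 2 2 / (real k * real m) \<and>
         (log 2 (real k * real m) - log 2 (real m) / real k = degree_entropy V E \<longleftrightarrow>
           isomorphic_hypergraphs V E (hyperstar_verts k m) (hyperstar_edges k m)) \<and>
         (degree_entropy V E
           = log 2 (real k * real m) - 2 * (real m - 1) * log 2 2 / (real k * real m) \<longleftrightarrow>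
           Max (degree E ` V) = 2)"
proof -
  interpret hypertree k V E
    using assms by unfold_locales (simp_all add: supertree_def)
  show ?thesis
    using degree_entropy_ge degree_entropy_le degree_entropy_eq_lower_iff
      degree_entropy_eq_upper_iff
    unfolding \<open>card E = m\<close> by blast
qed

end
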